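(* Let $n\ge 1$ and $m\ge 0$ be integers, let $f \in C^{m+1}(\mathbb{R}^n)$ and $\mathbf{z}_0 \in \mathbb{C}^n$. Then for all $\mathbf{x}\in\mathbb{R}^n$, $$ \frac{f(\mathbf{x})}{(n-1)!} = \sum_{k=0}^m \frac{(-1)^k}{(n+k)!} \nabla \cdot \bigl( (\mathbf{x}-\mathbf{z}_0)\, \nabla^k f : (\mathbf{x}-\mathbf{z}_0)^k \bigr) + \frac{(-1)^{m+1}}{(n+m)!} \nabla^{m+1} f : (\mathbf{x}-\mathbf{z}_0)^{m+1}. $$ If $f \in C^\infty(\mathbb{R}^n)$, the infinite series expansion $$ \frac{f(\mathbf{x})}{(n-1)!} = \sum_{k=0}^\infty \frac{(-1)^k}{(n+k)!} \nabla \cdot \bigl( (\mathbf{x}-\mathbf{z}_0)\, \nabla^k f : (\mathbf{x}-\mathbf{z}_0)^k \bigr) $$ holds, provided the series converges.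
   Context: For an integer $k\ge 0$, a sufficiently smooth function $f$ on $\mathbb{R}^n$ and a vector $\mathbf{y}=(y_1,\dots,y_n)$ (real or complex), the notation is $$\nabla^k f : \mathbf{y}^k := \sum_{1\le j_1,\dots,j_k\le n} y_{j_1}\cdots y_{j_k}\,\partial^k_{j_1,\dots,j_k} f ,$$ with $\nabla^0 f:\mathbf{y}^0 = f$. With $\mathbf{y}=\mathbf{x}-\mathbf{z}_0$, the expression $\nabla^k f:(\mathbf{x}-\mathbf{z}_0)^k$ is the scalar function $\mathbf{x}\mapsto \sum (\mathbf{x}-\mathbf{z}_0)_{j_1}\cdots(\mathbf{x}-\mathbf{z}_0)_{j_k}\,\partial^k_{j_1,\dots,j_k} f(\mathbf{x})$, with the derivatives of $f$ evaluated at $\mathbf{x}$. The divergence $\nabla\cdot$ is taken with respect to $\mathbf{x}\in\mathbb{R}^n$ of the vector field obtained by multiplying the vector $\mathbf{x}-\mathbf{z}_0$ by this scalar function.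
   Formalization: The infinite expansion can fail though the series converges (n=1, z₀=0, f=1/x near x=1). Proved instead: if the series converges, f(x)/(n-1)! is its sum plus the limit of the remainder term; if the remainder tends to 0, the series converges to f(x)/(n-1)!. *)

theory Defs
  imports "HOL-Analysis.Analysis"
begin

text \<open>
  Functions on the space \<open>real ^ 'n\<close> are complex-valued; real-valued functions are the special case of values
  in the image of \<open>of_real\<close>. The dimension is \<open>n = CARD('n)\<close>, so \<open>n \<ge> 1\<close> holds automatically.
\<close>

definition has_partial_at :: "'n::finite \<Rightarrow> (real ^ 'n \<Rightarrow> complex) \<Rightarrow> real ^ 'n \<Rightarrow> bool" where
  "has_partial_at j f x \<longleftrightarrow> (\<lambda>t::real. f (x + t *\<^sub>R axis j 1)) differentiable (at 0)"

definition partial :: "'n::finite \<Rightarrow> (real ^ 'n \<Rightarrow> complex) \<Rightarrow> real ^ 'n \<Rightarrow> complex" where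
  "partial j f x = vector_derivative (\<lambda>t::real. f (x + t *\<^sub>R axis j 1)) (at 0)"

text \<open>\<open>partials [j1, \<dots>, jk] f\<close> is \<open>\<partial>\<^bsub>j1\<^esub> (\<dots> (\<partial>\<^bsub>jk\<^esub> f))\<close>.\<close>

definition partials :: "'n::finite list \<Rightarrow> (real ^ 'n \<Rightarrow> complex) \<Rightarrow> real ^ 'n \<Rightarrow> complex" where
  "partials js f = foldr partial js f"

definition C_k :: "nat \<Rightarrow> (real ^ 'n::finite \<Rightarrow> complex) \<Rightarrow> bool" where
  "C_k k f \<longleftrightarrow>
     (\<forall>js j x. length js < k \<longrightarrow> has_partial_at j (partials js f) x) \<and>
     (\<forall>js. length js \<le> k \<longrightarrow> continuous_on UNIV (partials js f))"

definition C_infinity :: "(real ^ 'n::finite \<Rightarrow> complex) \<Rightarrow> bool" where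
  "C_infinity f \<longleftrightarrow> (\<forall>k. C_k k f)"

definition nabla_contract ::
    "nat \<Rightarrow> (real ^ 'n::finite \<Rightarrow> complex) \<Rightarrow> complex ^ 'n \<Rightarrow> real ^ 'n \<Rightarrow> complex" where
  "nabla_contract k f y x =
     (\<Sum>js | length js = k. (\<Prod>i<k. y $ (js ! i)) * partials js f x)"

definition divergence :: "(real ^ 'n::finite \<Rightarrow> complex ^ 'n) \<Rightarrow> real ^ 'n \<Rightarrow> complex" where
  "divergence F x = (\<Sum>j\<in>UNIV. partial j (\<lambda>u. F u $ j) x)"

definition displacement :: "complex ^ 'n::finite \<Rightarrow> real ^ 'n \<Rightarrow> complex ^ 'n" where
  "displacement z\<^sub>0 x = (\<chi> j. of_real (x $ j) - z\<^sub>0 $ j)"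

definition expansion_term ::
    "complex ^ 'n::finite \<Rightarrow> (real ^ 'n \<Rightarrow> complex) \<Rightarrow> real ^ 'n \<Rightarrow> nat \<Rightarrow> complex" where
  "expansion_term z\<^sub>0 f x k =
     (-1) ^ k / fact (CARD('n) + k) *
     divergence (\<lambda>u. nabla_contract k f (displacement z\<^sub>0 u) u *s displacement z\<^sub>0 u) x"

text \<open>
  The last summand of the finite expansion. Convergence of the series formed by the terms
  \<open>expansion_term\<close> does not make it tend to \<open>0\<close>: for \<open>n = 1\<close>, non-real \<open>z\<^sub>0\<close> and \<open>f x = 1 / (x - z\<^sub>0)\<close>
  all terms of the series vanish identically, and the remainder is \<open>f x\<close> for every \<open>m\<close>.
\<close>

definition expansion_remainder ::
    "complex ^ 'n::finite \<Rightarrow> (real ^ 'n \<Rightarrow> complex) \<Rightarrow> real ^ 'n \<Rightarrow> nat \<Rightarrow> complex" where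
  "expansion_remainder z\<^sub>0 f x m =
     (-1) ^ (m + 1) / fact (CARD('n) + m) *
     nabla_contract (m + 1) f (displacement z\<^sub>0 x) x"

end

theory Submission
  imports Defs
begin

text \<open>
  Write \<open>y = x - z\<^sub>0\<close>, \<open>n = CARD('n)\<close> and \<open>N\<^sub>k\<close> for the scalar function \<open>\<nabla>\<^sup>k f : y\<^sup>k\<close>, and let
  \<open>E = \<Sum>\<^sub>j y\<^sub>j \<partial>\<^sub>j\<close> be the Euler operator centred at \<open>z\<^sub>0\<close>. The proof rests on three facts.

  First, \<open>\<nabla> \<cdot> (h y) = n h + E h\<close>, since \<open>\<partial>\<^sub>j y\<^sub>j = 1\<close> (\<open>divergence_times_displacement\<close>).
  Secondly, \<open>E\<close> is a derivation that multiplies a monomial of degree \<open>k\<close> in \<open>y\<close> by \<open>k\<close>, so that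
  applying it to \<open>N\<^sub>k\<close> gives \<open>E N\<^sub>k = k N\<^sub>k + N\<^bsub>k+1\<^esub>\<close>: the first part comes from the monomials, the
  second from the derivatives of \<open>f\<close> (\<open>has_euler_deriv_nabla_contract\<close>). Together,
  \<open>\<nabla> \<cdot> (N\<^sub>k y) = (n + k) N\<^sub>k + N\<^bsub>k+1\<^esub>\<close>.
  Thirdly, after multiplication by \<open>(-1)\<^sup>k / (n + k)!\<close> the right-hand side is a difference
  \<open>a\<^sub>k - a\<^bsub>k+1\<^esub>\<close> with \<open>a\<^sub>k = (-1)\<^sup>k N\<^sub>k / (n + k - 1)!\<close> (\<open>expansion_term_eq_diff\<close>), so the sum telescopes.
  Its first endpoint \<open>a\<^sub>0\<close> is \<open>f / (n - 1)!\<close>, and \<open>a\<^bsub>m+1\<^esub>\<close> is exactly the remainder. The statements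
  on the series follow by letting \<open>m\<close> tend to infinity.

  In \<open>E N\<^sub>k\<close> the new derivative \<open>\<partial>\<^sub>j\<close> is applied on the outside, which is also how a list of length
  \<open>k + 1\<close> arises from one of length \<open>k\<close>; so the summands of \<open>N\<^bsub>k+1\<^esub>\<close> are matched one by one.
\<close>

text \<open>
  This is \<open>E h = e\<close> at \<open>x\<close>. The operator is built from partial derivatives because \<open>z\<^sub>0\<close> may be
  complex, and \<open>x - z\<^sub>0\<close> is then not a direction in the domain of \<open>h\<close>. Hiding the partial
  derivatives \<open>D\<close> lets the derivation rules be stated for \<open>e\<close> alone.
\<close>

definition has_euler_deriv ::
    "complex ^ 'n::finite \<Rightarrow> (real ^ 'n \<Rightarrow> complex) \<Rightarrow> complex \<Rightarrow> real ^ 'n \<Rightarrow> bool" where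
  "has_euler_deriv z\<^sub>0 h e x \<longleftrightarrow>
     (\<exists>D. (\<forall>j. ((\<lambda>t::real. h (x + t *\<^sub>R axis j 1)) has_vector_derivative D j) (at 0)) \<and>
          (\<Sum>j\<in>UNIV. displacement z\<^sub>0 x $ j * D j) = e)"

lemma has_euler_deriv_const: "has_euler_deriv z\<^sub>0 (\<lambda>u. c) 0 x"
  unfolding has_euler_deriv_def by (intro exI[of _ "\<lambda>j. 0"]) simp

lemma has_vector_derivative_displacement:
  "((\<lambda>t::real. displacement z\<^sub>0 (x + t *\<^sub>R axis j 1) $ l)
      has_vector_derivative (if l = j then 1 else 0)) (at 0)"
proof -
  have "(\<lambda>t::real. displacement z\<^sub>0 (x + t *\<^sub>R axis j 1) $ l) =
      (\<lambda>t. of_real (x $ l) - z\<^sub>0 $ l + t *\<^sub>R (if l = j then 1 else 0))"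
    by (auto simp: displacement_def axis_def scaleR_conv_of_real[where 'a = complex])
  then show ?thesis
    by (auto intro!: derivative_eq_intros)
qed

lemma has_euler_deriv_displacement:
  "has_euler_deriv z\<^sub>0 (\<lambda>u. displacement z\<^sub>0 u $ l) (displacement z\<^sub>0 x $ l) x"
  unfolding has_euler_deriv_def
  by (intro exI[of _ "\<lambda>j. if l = j then 1 else 0"] conjI allI
      has_vector_derivative_displacement) (simp add: if_distrib cong: if_cong)

lemma has_euler_deriv_mult:
  assumes "has_euler_deriv z\<^sub>0 g d x" and "has_euler_deriv z\<^sub>0 h e x"
  shows "has_euler_deriv z\<^sub>0 (\<lambda>u. g u * h u) (d * h x + g x * e) x"
proof -
  obtain D where D:
      "\<And>j. ((\<lambda>t::real. g (x + t *\<^sub>R axis j 1)) has_vector_derivative D j) (at 0)"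
      "(\<Sum>j\<in>UNIV. displacement z\<^sub>0 x $ j * D j) = d"
    using assms(1) unfolding has_euler_deriv_def by blast
  obtain E where E:
      "\<And>j. ((\<lambda>t::real. h (x + t *\<^sub>R axis j 1)) has_vector_derivative E j) (at 0)"
      "(\<Sum>j\<in>UNIV. displacement z\<^sub>0 x $ j * E j) = e"
    using assms(2) unfolding has_euler_deriv_def by blast
  have "((\<lambda>t::real. g (x + t *\<^sub>R axis j 1) * h (x + t *\<^sub>R axis j 1))
      has_vector_derivative g x * E j + D j * h x) (at 0)" for j
    using has_vector_derivative_mult[OF D(1) E(1), of j j] by simp
  moreover have "(\<Sum>j\<in>UNIV. displacement z\<^sub>0 x $ j * (g x * E j + D j * h x)) = d * h x + g x * e"
    unfolding D(2)[symmetric] E(2)[symmetric]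
    by (simp add: sum_distrib_left sum_distrib_right sum.distrib algebra_simps)
  ultimately show ?thesis
    unfolding has_euler_deriv_def by (intro exI[of _ "\<lambda>j. g x * E j + D j * h x"]) simp
qed

lemma has_euler_deriv_sum:
  assumes "\<And>i. i \<in> A \<Longrightarrow> has_euler_deriv z\<^sub>0 (h i) (e i) x"
  shows "has_euler_deriv z\<^sub>0 (\<lambda>u. \<Sum>i\<in>A. h i u) (\<Sum>i\<in>A. e i) x"
proof -
  from assms obtain D where D:
      "\<And>i j. i \<in> A \<Longrightarrow> ((\<lambda>t::real. h i (x + t *\<^sub>R axis j 1)) has_vector_derivative D i j) (at 0)"
      "\<And>i. i \<in> A \<Longrightarrow> (\<Sum>j\<in>UNIV. displacement z\<^sub>0 x $ j * D i j) = e i"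
    unfolding has_euler_deriv_def by metis
  have "(\<Sum>j\<in>UNIV. displacement z\<^sub>0 x $ j * (\<Sum>i\<in>A. D i j)) =
      (\<Sum>i\<in>A. \<Sum>j\<in>UNIV. displacement z\<^sub>0 x $ j * D i j)"
    unfolding sum_distrib_left by (rule sum.swap)
  also have "\<dots> = (\<Sum>i\<in>A. e i)"
    by (rule sum.cong) (auto simp: D(2))
  finally show ?thesis
    unfolding has_euler_deriv_def
    by (intro exI[of _ "\<lambda>j. \<Sum>i\<in>A. D i j"]) (auto intro: has_vector_derivative_sum D(1))
qed

text \<open>
  Euler's identity for homogeneous functions, for the monomials of \<open>\<nabla>\<^sup>k f : y\<^sup>k\<close>: by the product
  rule each of the factors contributes the monomial once.
\<close>

lemma has_euler_deriv_monomial: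
  "has_euler_deriv z\<^sub>0 (\<lambda>u. \<Prod>i<length js. displacement z\<^sub>0 u $ (js ! i))
     (of_nat (length js) * (\<Prod>i<length js. displacement z\<^sub>0 x $ (js ! i))) x"
proof (induction js)
  case Nil
  show ?case using has_euler_deriv_const[of z\<^sub>0 1] by simp
next
  case (Cons l js)
  show ?case
    using has_euler_deriv_mult[OF has_euler_deriv_displacement[of z\<^sub>0 l x] Cons.IH]
    by (simp add: prod.lessThan_Suc_shift algebra_simps del: prod.lessThan_Suc)
qed

lemma has_partial_at_iff:
  "has_partial_at j h x \<longleftrightarrow>
     ((\<lambda>t::real. h (x + t *\<^sub>R axis j 1)) has_vector_derivative partial j h x) (at 0)"
  unfolding has_partial_at_def partial_def by (rule vector_derivative_works)

lemma has_euler_deriv_partials: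
  assumes "\<And>j. has_partial_at j (partials js f) x"
  shows "has_euler_deriv z\<^sub>0 (partials js f)
           (\<Sum>j\<in>UNIV. displacement z\<^sub>0 x $ j * partials (j # js) f x) x"
  using assms unfolding has_euler_deriv_def has_partial_at_iff
  by (intro exI[of _ "\<lambda>j. partials (j # js) f x"]) (simp add: partials_def)

lemma sum_lists_length_Suc:
  "(\<Sum>js | length js = Suc k. g js) =
     (\<Sum>js | length js = k. \<Sum>j\<in>(UNIV :: 'n::finite set). g (j # js))"
proof -
  have "(\<Sum>js | length js = Suc k. g js) =
      (\<Sum>(js, j)\<in>{js. length js = k} \<times> (UNIV :: 'n set). g (j # js))"
    by (rule sum.reindex_bij_witness[where i = "\<lambda>(js, j). j # js" and j = "\<lambda>js. (tl js, hd js)"])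
      (auto simp: length_Suc_conv)
  then show ?thesis
    by (simp add: sum.cartesian_product)
qed

text \<open>
  Leibniz' rule on each summand \<open>y\<^bsub>j1\<^esub> \<dots> y\<^bsub>jk\<^esub> \<partial>\<^bsub>j1\<^esub> \<dots> \<partial>\<^bsub>jk\<^esub> f\<close> gives \<open>k\<close> times the summand from the
  monomial, and one summand of order \<open>k + 1\<close> for each outer derivative \<open>\<partial>\<^sub>j\<close> from the other factor.
\<close>

lemma has_euler_deriv_nabla_contract:
  assumes "\<And>js j. length js = k \<Longrightarrow> has_partial_at j (partials js f) x"
  shows "has_euler_deriv z\<^sub>0 (\<lambda>u. nabla_contract k f (displacement z\<^sub>0 u) u)
           (of_nat k * nabla_contract k f (displacement z\<^sub>0 x) x
            + nabla_contract (Suc k) f (displacement z\<^sub>0 x) x) x"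
proof -
  let ?y = "\<lambda>js u. \<Prod>i<k. displacement z\<^sub>0 u $ (js ! i)"
  have "has_euler_deriv z\<^sub>0 (\<lambda>u. ?y js u * partials js f u)
      (of_nat k * ?y js x * partials js f x
       + ?y js x * (\<Sum>j\<in>UNIV. displacement z\<^sub>0 x $ j * partials (j # js) f x)) x"
    if "js \<in> {js. length js = k}" for js
    using that has_euler_deriv_mult[OF has_euler_deriv_monomial[of z\<^sub>0 js x]
        has_euler_deriv_partials[of js f x z\<^sub>0]] assms by auto
  from has_euler_deriv_sum[of "{js. length js = k}", OF this]
  show ?thesis
    unfolding nabla_contract_def sum_lists_length_Suc
    by (simp add: sum.distrib sum_distrib_left prod.lessThan_Suc_shift mult_ac
        del: prod.lessThan_Suc)
qed

lemma divergence_times_displacement: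
  fixes h :: "real ^ 'n::finite \<Rightarrow> complex"
  assumes "has_euler_deriv z\<^sub>0 h e x"
  shows "divergence (\<lambda>u. h u *s displacement z\<^sub>0 u) x = of_nat CARD('n) * h x + e"
proof -
  obtain D where D:
      "\<And>j. ((\<lambda>t::real. h (x + t *\<^sub>R axis j 1)) has_vector_derivative D j) (at 0)"
      "(\<Sum>j\<in>UNIV. displacement z\<^sub>0 x $ j * D j) = e"
    using assms unfolding has_euler_deriv_def by blast
  have "partial j (\<lambda>u. (h u *s displacement z\<^sub>0 u) $ j) x = h x + displacement z\<^sub>0 x $ j * D j" for j
  proof -
    have "((\<lambda>t::real. h (x + t *\<^sub>R axis j 1) * displacement z\<^sub>0 (x + t *\<^sub>R axis j 1) $ j)
        has_vector_derivative h x + displacement z\<^sub>0 x $ j * D j) (at 0)"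
      using has_vector_derivative_mult[OF D(1) has_vector_derivative_displacement, of j z\<^sub>0 x j j]
      by (simp add: mult.commute)
    then show ?thesis
      by (simp add: partial_def vector_derivative_at)
  qed
  then show ?thesis
    by (simp add: divergence_def sum.distrib D(2))
qed

text \<open>
  The quantities \<open>a\<^sub>k\<close> between which the terms of the expansion telescope. Since \<open>n \<ge> 1\<close>, the
  subtraction on natural numbers is not truncated, even for \<open>k = 0\<close>.
\<close>

definition telescoping_coeff ::
    "complex ^ 'n::finite \<Rightarrow> (real ^ 'n \<Rightarrow> complex) \<Rightarrow> real ^ 'n \<Rightarrow> nat \<Rightarrow> complex" where
  "telescoping_coeff z\<^sub>0 f x k =
     (-1) ^ k / fact (CARD('n) + k - 1) * nabla_contract k f (displacement z\<^sub>0 x) x"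

lemma telescoping_coeff_0:
  fixes f :: "real ^ 'n::finite \<Rightarrow> complex"
  shows "telescoping_coeff z\<^sub>0 f x 0 = f x / fact (CARD('n) - 1)"
  by (simp add: telescoping_coeff_def nabla_contract_def partials_def)

lemma telescoping_coeff_Suc:
  "telescoping_coeff z\<^sub>0 f x (Suc m) = expansion_remainder z\<^sub>0 f x m"
  by (simp add: telescoping_coeff_def expansion_remainder_def)

text \<open>
  The factor \<open>n + k\<close> in \<open>\<nabla> \<cdot> (N\<^sub>k y) = (n + k) N\<^sub>k + N\<^bsub>k+1\<^esub>\<close> cancels against \<open>(n + k)!\<close>, which is what
  makes the factorials the right weights.
\<close>

lemma expansion_term_eq_diff:
  fixes f :: "real ^ 'n::finite \<Rightarrow> complex"
  assumes "C_k m f" and "k < m"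
  shows "expansion_term z\<^sub>0 f x k = telescoping_coeff z\<^sub>0 f x k - telescoping_coeff z\<^sub>0 f x (Suc k)"
proof -
  let ?N = "\<lambda>k. nabla_contract k f (displacement z\<^sub>0 x) x"
  have "has_euler_deriv z\<^sub>0 (\<lambda>u. nabla_contract k f (displacement z\<^sub>0 u) u)
      (of_nat k * ?N k + ?N (Suc k)) x"
    using assms by (intro has_euler_deriv_nabla_contract) (simp add: C_k_def)
  from divergence_times_displacement[OF this]
  have "expansion_term z\<^sub>0 f x k =
      (-1) ^ k / fact (CARD('n) + k) * (of_nat (CARD('n) + k) * ?N k + ?N (Suc k))"
    by (simp add: expansion_term_def algebra_simps)
  also have "\<dots> = (-1) ^ k * (of_nat (CARD('n) + k) / fact (CARD('n) + k)) * ?N k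
      + (-1) ^ k / fact (CARD('n) + k) * ?N (Suc k)"
    by (simp add: distrib_left del: of_nat_add)
  also have "of_nat (CARD('n) + k) / fact (CARD('n) + k)
      = (1 / fact (CARD('n) + k - 1) :: complex)"
    using fact_reduce[of "CARD('n) + k", where 'a = complex] by (simp del: of_nat_add)
  finally show ?thesis
    by (simp add: telescoping_coeff_def)
qed

lemma finite_expansion:
  fixes f :: "real ^ 'n::finite \<Rightarrow> complex"
  assumes "C_k (m + 1) f"
  shows "f x / fact (CARD('n) - 1) =
           (\<Sum>k=0..m. expansion_term z\<^sub>0 f x k) + expansion_remainder z\<^sub>0 f x m"
proof -
  let ?a = "telescoping_coeff z\<^sub>0 f x"
  have "(\<Sum>k=0..m. expansion_term z\<^sub>0 f x k) = (\<Sum>k<Suc m. ?a k - ?a (Suc k))"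
    using expansion_term_eq_diff[OF assms] by (intro sum.cong) auto
  also have "\<dots> = ?a 0 - ?a (Suc m)"
    by (rule sum_lessThan_telescope')
  finally show ?thesis
    by (simp add: telescoping_coeff_0 telescoping_coeff_Suc)
qed

theorem theorem4p3:
  fixes f :: "real ^ 'n \<Rightarrow> complex" and z\<^sub>0 :: "complex ^ 'n"
  shows
    "(\<forall>m::nat. C_k (m + 1) f \<longrightarrow>
        (\<forall>x. f x / fact (CARD('n) - 1) =
               (\<Sum>k=0..m. expansion_term z\<^sub>0 f x k) + expansion_remainder z\<^sub>0 f x m)) \<and>
     (C_infinity f \<longrightarrow>
        (\<forall>x. summable (expansion_term z\<^sub>0 f x) \<longrightarrow>
               convergent (expansion_remainder z\<^sub>0 f x) \<and>
               f x / fact (CARD('n) - 1) =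
                 (\<Sum>k. expansion_term z\<^sub>0 f x k) + lim (expansion_remainder z\<^sub>0 f x)) \<and>
        (\<forall>x. expansion_remainder z\<^sub>0 f x \<longlonglongrightarrow> 0 \<longrightarrow>
               expansion_term z\<^sub>0 f x sums (f x / fact (CARD('n) - 1))))"
proof (intro conjI allI impI)
  fix m x
  assume "C_k (m + 1) f"
  then show "f x / fact (CARD('n) - 1) =
      (\<Sum>k=0..m. expansion_term z\<^sub>0 f x k) + expansion_remainder z\<^sub>0 f x m"
    by (rule finite_expansion)
next
  fix x
  assume smooth: "C_infinity f"
  let ?s = "\<lambda>m. \<Sum>k=0..m. expansion_term z\<^sub>0 f x k" and ?r = "expansion_remainder z\<^sub>0 f x"
  have expansion: "f x / fact (CARD('n) - 1) = ?s m + ?r m" for m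
    using smooth by (intro finite_expansion) (simp add: C_infinity_def)
  {
    assume "summable (expansion_term z\<^sub>0 f x)"
    then have "?s \<longlonglongrightarrow> (\<Sum>k. expansion_term z\<^sub>0 f x k)"
      by (simp add: summable_LIMSEQ' atLeast0AtMost)
    then have "(\<lambda>m. f x / fact (CARD('n) - 1) - ?s m) \<longlonglongrightarrow>
        f x / fact (CARD('n) - 1) - (\<Sum>k. expansion_term z\<^sub>0 f x k)"
      by (intro tendsto_diff tendsto_const)
    moreover have "(\<lambda>m. f x / fact (CARD('n) - 1) - ?s m) = ?r"
      using expansion by (simp add: fun_eq_iff algebra_simps)
    ultimately have lim: "?r \<longlonglongrightarrow> f x / fact (CARD('n) - 1) - (\<Sum>k. expansion_term z\<^sub>0 f x k)"
      by simp
    then show "convergent ?r"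
      by (rule convergentI)
    from limI[OF lim]
    show "f x / fact (CARD('n) - 1) = (\<Sum>k. expansion_term z\<^sub>0 f x k) + lim ?r"
      by simp
  }
  {
    assume "?r \<longlonglongrightarrow> 0"
    then have "(\<lambda>m. f x / fact (CARD('n) - 1) - ?r m) \<longlonglongrightarrow> f x / fact (CARD('n) - 1) - 0"
      by (intro tendsto_diff tendsto_const)
    moreover have "(\<lambda>m. f x / fact (CARD('n) - 1) - ?r m) = ?s"
      using expansion by (simp add: fun_eq_iff algebra_simps)
    ultimately show "expansion_term z\<^sub>0 f x sums (f x / fact (CARD('n) - 1))"
      by (simp add: sums_def_le atLeast0AtMost)
  }
qed

end
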